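(* Let $G$ be a finite simple connected graph with $n$ vertices, let $S$ be one of $P(G)$, $T(G)$, $C(G)$, let $f\in S$, and let $E_{\lambda_1}$ be the eigenspace of $\Delta_f$ for its smallest positive eigenvalue. Then $f$ maximizes $\lambda_1$ over $S$ if and only if the intersection of $S^\perp$ with the open cone generated by $\mathcal{P}_{\lambda_1}=\{P_x : x\in E_{\lambda_1}\}$ is nonempty.
   Context: $P(G)=\{f:E(G)\to(0,\infty) : \sum_{e} f(e)=|E(G)|\}$; $T(G)=\{f\in P(G): \sum_{e \text{ incident to } v} f(e)=\deg v \ \forall v\}$; $C(G)=\{f\in P(G): \exists\, g:V(G)\to(0,\infty),\ f(e_{vw})=g(v)+g(w) \text{ for each edge } e_{vw}\}$. For $h:E(G)\to\mathbb{R}$, $\Delta_h$ is the matrix of $(\Delta_h u)(v)=\sum_{w\sim v}h(vw)(u(v)-u(w))$. Tangent directions of $S$: for $P(G)$, all $h$ with $\sum_e h(e)=0$; for $T(G)$, all $h$ with $\sum_{e\text{ incident to }v}h(e)=0$ for all $v$; for $C(G)$, all $h(e_{vw})=a(v)+a(w)$ with $a:V(G)\to\mathbb{R}$ and $\sum_e h(e)=0$. $S^\perp$ is the orthogonal complement, in the space of real symmetric $n\times n$ matrices with inner product $\langle A,B\rangle=\mathrm{tr}(AB)$, of $\{\Delta_h: h \text{ a tangent direction of } S\}$. For $x\in\mathbb{R}^n$, $P_x=xx^t$. The open cone generated by a set of matrices consists of all finite linear combinations of its elements with coefficients all strictly positive or all strictly negative.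
   Formalization: The matrices P_x are taken only for nonzero x in the eigenspace and combinations in the open cone are nonempty (otherwise the zero matrix always lies in the intersection and the claim fails); n is at least 2, so that a smallest positive eigenvalue exists. *)

theory Defs
  imports "HOL-Analysis.Analysis"
begin

text \<open>
  A graph is given by its edge set \<open>E\<close>, consisting of two-element subsets of the finite vertex
  type \<open>'n\<close>; the vertex set is the whole type.
\<close>

definition simple_graph :: "'n::finite set set \<Rightarrow> bool" where
  "simple_graph E \<longleftrightarrow> (\<forall>e\<in>E. card e = 2)"

definition connected_graph :: "'n::finite set set \<Rightarrow> bool" where
  "connected_graph E \<longleftrightarrow> (\<forall>u v. (u, v) \<in> {(x, y). {x, y} \<in> E}\<^sup>*)"

definition incident :: "'n::finite set set \<Rightarrow> 'n \<Rightarrow> 'n set set" where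
  "incident E v = {e \<in> E. v \<in> e}"

definition deg :: "'n::finite set set \<Rightarrow> 'n \<Rightarrow> nat" where
  "deg E v = card (incident E v)"

text \<open>
  Functions on edges are total functions on sets of vertices; every notion below
  depends only on their values on \<open>E\<close>.
\<close>

definition weights_P :: "'n::finite set set \<Rightarrow> ('n set \<Rightarrow> real) set" where
  "weights_P E = {f. (\<forall>e\<in>E. 0 < f e) \<and> (\<Sum>e\<in>E. f e) = real (card E)}"

definition weights_T :: "'n::finite set set \<Rightarrow> ('n set \<Rightarrow> real) set" where
  "weights_T E = {f \<in> weights_P E. \<forall>v. (\<Sum>e\<in>incident E v. f e) = real (deg E v)}"

definition weights_C :: "'n::finite set set \<Rightarrow> ('n set \<Rightarrow> real) set" where
  "weights_C E = {f \<in> weights_P E. \<exists>g :: 'n \<Rightarrow> real. (\<forall>v. 0 < g v) \<and>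
     (\<forall>v w. {v, w} \<in> E \<longrightarrow> f {v, w} = g v + g w)}"

definition tangent_P :: "'n::finite set set \<Rightarrow> ('n set \<Rightarrow> real) set" where
  "tangent_P E = {h. (\<Sum>e\<in>E. h e) = 0}"

definition tangent_T :: "'n::finite set set \<Rightarrow> ('n set \<Rightarrow> real) set" where
  "tangent_T E = {h. \<forall>v. (\<Sum>e\<in>incident E v. h e) = 0}"

definition tangent_C :: "'n::finite set set \<Rightarrow> ('n set \<Rightarrow> real) set" where
  "tangent_C E = {h. (\<exists>a :: 'n \<Rightarrow> real. \<forall>v w. {v, w} \<in> E \<longrightarrow> h {v, w} = a v + a w)
     \<and> (\<Sum>e\<in>E. h e) = 0}"

definition laplacian :: "'n::finite set set \<Rightarrow> ('n set \<Rightarrow> real) \<Rightarrow> real^'n^'n" where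
  "laplacian E h = matrix (\<lambda>u. \<chi> v. \<Sum>w | {v, w} \<in> E. h {v, w} * (u $ v - u $ w))"

definition eigenspace :: "real^'n^'n \<Rightarrow> real \<Rightarrow> (real^'n::finite) set" where
  "eigenspace A l = {x. A *v x = l *\<^sub>R x}"

definition is_eigenvalue :: "real^'n^'n \<Rightarrow> real \<Rightarrow> bool" where
  "is_eigenvalue (A :: real^'n::finite^'n) l \<longleftrightarrow> (\<exists>x\<in>eigenspace A l. x \<noteq> 0)"

definition lambda1 :: "'n::finite set set \<Rightarrow> ('n set \<Rightarrow> real) \<Rightarrow> real" where
  "lambda1 E f = (LEAST l. 0 < l \<and> is_eigenvalue (laplacian E f) l)"

definition perp :: "'n::finite set set \<Rightarrow> ('n set \<Rightarrow> real) set \<Rightarrow> (real^'n^'n) set" where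
  "perp E H = {A. transpose A = A \<and> (\<forall>h\<in>H. trace (A ** laplacian E h) = 0)}"

definition outer_square :: "real^'n \<Rightarrow> real^'n^'n" where
  "outer_square (x :: real^'n::finite) = (columnvector x :: real^1^'n) ** transpose (columnvector x)"

text \<open>
  Only nonzero eigenvectors and nonempty combinations are admitted: the zero matrix is orthogonal
  to everything, so otherwise the intersection with the cone would never be empty.
\<close>

definition eigen_squares :: "'n::finite set set \<Rightarrow> ('n set \<Rightarrow> real) \<Rightarrow> (real^'n^'n) set" where
  "eigen_squares E f = {outer_square x | x. x \<in> eigenspace (laplacian E f) (lambda1 E f) \<and> x \<noteq> 0}"

definition open_cone :: "'a::real_vector set \<Rightarrow> 'a set" where
  "open_cone X = {\<Sum>B\<in>F. c B *\<^sub>R B | F c. finite F \<and> F \<noteq> {} \<and> F \<subseteq> X \<and>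
     ((\<forall>B\<in>F. (0::real) < c B) \<or> (\<forall>B\<in>F. c B < 0))}"

end

theory Submission imports Defs begin

text \<open>
  By the Rayleigh principle \<open>\<lambda>\<^sub>1(f)\<close> is the minimum of \<open>x \<bullet> \<Delta>\<^sub>f x\<close> over the unit vectors \<open>x\<close>
  orthogonal to the constants, attained exactly at the unit eigenvectors. As \<open>\<Delta>\<^sub>f\<close> is linear in
  \<open>f\<close>, an element of \<open>S\<^sup>\<bottom>\<close> in the cone yields for every competitor \<open>f'\<close> an eigenvector \<open>x\<close>
  of \<open>\<Delta>\<^sub>f\<close> with \<open>x \<bullet> \<Delta>\<^bsub>f' - f\<^esub> x \<le> 0\<close>, so \<open>\<lambda>\<^sub>1(f') \<le> \<lambda>\<^sub>1(f)\<close>. Conversely, if the compact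
  convex hull of the \<open>P\<^sub>x\<close>, for unit eigenvectors \<open>x\<close>, misses \<open>S\<^sup>\<bottom>\<close>, a separating hyperplane has
  a normal \<open>\<Delta>\<^sub>h\<close> with \<open>h\<close> tangent, and moving \<open>f\<close> along \<open>h\<close> increases \<open>\<lambda>\<^sub>1\<close>.
\<close>

section \<open>The weighted Laplacian and its Dirichlet form\<close>

lemma laplacian_mult_vec:
  fixes u :: "real^'n::finite"
  shows
  "(laplacian E h *v u) $ v = (\<Sum>w\<in>UNIV. if {v, w} \<in> E then h {v, w} * (u $ v - u $ w) else 0)"
proof -
  have "linear (\<lambda>u::real^'n. \<chi> v. \<Sum>w | {v, w} \<in> E. h {v, w} * (u $ v - u $ w))"
    by (rule linearI)
      (auto simp: vec_eq_iff sum.distrib[symmetric] sum_distrib_left algebra_simps intro!: sum.cong)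
  then have "laplacian E h *v u = (\<chi> v. \<Sum>w | {v, w} \<in> E. h {v, w} * (u $ v - u $ w))"
    unfolding laplacian_def by (simp add: matrix_works linear_matrix_vector_mul_eq)
  then show ?thesis
    by (simp add: sum.If_cases)
qed

lemma laplacian_add: "laplacian E (\<lambda>e. h e + k e) = laplacian E h + laplacian E k"
  unfolding matrix_eq
  by (auto simp: vec_eq_iff matrix_vector_mult_add_rdistrib laplacian_mult_vec
      sum.distrib[symmetric] algebra_simps intro!: sum.cong)

lemma laplacian_scale: "laplacian E (\<lambda>e. c * h e) = c *\<^sub>R laplacian E h"
  unfolding matrix_eq
  by (auto simp: vec_eq_iff scaleR_matrix_vector_assoc[symmetric] laplacian_mult_vec
      sum_distrib_left intro!: sum.cong)

lemma laplacian_one: "laplacian E h *v 1 = 0"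
  by (auto simp: vec_eq_iff laplacian_mult_vec intro!: sum.neutral)

text \<open>The polarised form is kept, not only the quadratic one, because the first variation in
  \<open>minimizer_in_eigenspace\<close> involves the mixed term.\<close>

definition dirichlet :: "'n::finite set set \<Rightarrow> ('n set \<Rightarrow> real) \<Rightarrow> real^'n \<Rightarrow> real^'n \<Rightarrow> real" where
  "dirichlet E h x y = y \<bullet> (laplacian E h *v x)"

text \<open>Exchanging the summation variables and adding turns the factor \<open>y $ v\<close> into
  a difference, at the price of the factor 2. Symmetry in \<open>x\<close>, \<open>y\<close> and
  nonnegativity for positive weights can then be read off.\<close>

lemma dirichlet_eq:
  "2 * dirichlet E h x y =
    (\<Sum>v\<in>UNIV. \<Sum>w\<in>UNIV. if {v, w} \<in> E then h {v, w} * (x $ v - x $ w) * (y $ v - y $ w) else 0)"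
proof -
  let ?a = "\<lambda>v w. if {v, w} \<in> E then h {v, w} * (x $ v - x $ w) * y $ v else 0"
  have 1: "dirichlet E h x y = (\<Sum>v\<in>UNIV. \<Sum>w\<in>UNIV. ?a v w)"
    by (auto simp: dirichlet_def inner_vec_def laplacian_mult_vec sum_distrib_left intro!: sum.cong)
  have 2: "dirichlet E h x y = (\<Sum>v\<in>UNIV. \<Sum>w\<in>UNIV. ?a w v)"
    unfolding 1 by (rule sum.swap)
  have "2 * dirichlet E h x y = (\<Sum>v\<in>UNIV. \<Sum>w\<in>UNIV. ?a v w + ?a w v)"
    using 1 2 by (simp add: sum.distrib)
  also have "\<dots> = (\<Sum>v\<in>UNIV. \<Sum>w\<in>UNIV.
      if {v, w} \<in> E then h {v, w} * (x $ v - x $ w) * (y $ v - y $ w) else 0)"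
    by (intro sum.cong refl) (auto simp: insert_commute algebra_simps)
  finally show ?thesis .
qed

lemma dirichlet_sym: "dirichlet E h x y = dirichlet E h y x"
proof -
  have "2 * dirichlet E h x y = 2 * dirichlet E h y x"
    unfolding dirichlet_eq by (intro sum.cong refl) (simp add: mult_ac)
  then show ?thesis by simp
qed

lemma dirichlet_add_left: "dirichlet E h (x + y) z = dirichlet E h x z + dirichlet E h y z"
  by (simp add: dirichlet_def matrix_vector_right_distrib inner_add_right)

lemma dirichlet_scale_left: "dirichlet E h (c *\<^sub>R x) z = c * dirichlet E h x z"
  by (simp add: dirichlet_def matrix_vector_mult_scaleR)

lemma dirichlet_add_right: "dirichlet E h z (x + y) = dirichlet E h z x + dirichlet E h z y"
  by (simp add: dirichlet_def inner_add_left)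

lemma dirichlet_scale_right: "dirichlet E h z (c *\<^sub>R x) = c * dirichlet E h z x"
  by (simp add: dirichlet_def)

lemma dirichlet_weight_add:
  "dirichlet E (\<lambda>e. h e + k e) x y = dirichlet E h x y + dirichlet E k x y"
  by (simp add: dirichlet_def laplacian_add matrix_vector_mult_add_rdistrib inner_add_right)

lemma dirichlet_weight_scale: "dirichlet E (\<lambda>e. c * h e) x y = c * dirichlet E h x y"
  by (simp add: dirichlet_def laplacian_scale scaleR_matrix_vector_assoc[symmetric])

lemma continuous_on_dirichlet: "continuous_on A (\<lambda>x. dirichlet E h x x)"
  unfolding dirichlet_def
  by (intro continuous_intros linear_continuous_on matrix_vector_mul_bounded_linear)

lemma dirichlet_nonneg:
  assumes "\<forall>e\<in>E. 0 < h e"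
  shows "0 \<le> dirichlet E h x x"
proof -
  have "0 \<le> 2 * dirichlet E h x x"
    unfolding dirichlet_eq mult.assoc using assms
    by (intro sum_nonneg) (auto intro: mult_nonneg_nonneg less_imp_le)
  then show ?thesis by simp
qed

text \<open>A vanishing sum of nonnegative terms makes \<open>x\<close> agree across every edge, and
  paths spread the agreement.\<close>

lemma dirichlet_eq_0_imp_constant:
  assumes pos: "\<forall>e\<in>E. 0 < h e" and "connected_graph E" and "dirichlet E h x x = 0"
  shows "x $ u = x $ v"
proof -
  define a where
    "a v w = (if {v, w} \<in> E then h {v, w} * (x $ v - x $ w) * (x $ v - x $ w) else 0)" for v w
  have nn: "0 \<le> a v w" for v w
    unfolding a_def mult.assoc using pos by (auto intro: mult_nonneg_nonneg less_imp_le)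
  have "(\<Sum>v\<in>UNIV. \<Sum>w\<in>UNIV. a v w) = 0"
    using assms(3) dirichlet_eq[of E h x x] by (simp add: a_def)
  then have zero: "a v w = 0" for v w
    by (simp add: sum_nonneg_eq_0_iff sum_nonneg nn)
  have edge: "x $ v = x $ w" if "{v, w} \<in> E" for v w
    using zero[of v w] that pos by (force simp: a_def)
  have "(u, v) \<in> {(x, y). {x, y} \<in> E}\<^sup>*"
    using assms(2) by (simp add: connected_graph_def)
  then show ?thesis
    by (induction) (auto dest: edge)
qed

section \<open>The Rayleigh principle and perturbation of \<open>lambda1\<close>\<close>

definition mean_zero_sphere :: "(real^'n::finite) set" where
  "mean_zero_sphere = {x. norm x = 1 \<and> x \<bullet> 1 = 0}"

lemma inner_one_vec: "x \<bullet> (1 :: real^'n::finite) = (\<Sum>v\<in>UNIV. x $ v)"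
  by (simp add: inner_vec_def)

lemma compact_mean_zero_sphere: "compact (mean_zero_sphere :: (real^'n::finite) set)"
proof -
  have "mean_zero_sphere = sphere (0::real^'n) 1 \<inter> {x. x \<bullet> 1 = 0}"
    by (auto simp: mean_zero_sphere_def)
  moreover have "closed {x :: real^'n. x \<bullet> 1 = 0}"
    by (intro closed_Collect_eq continuous_intros)
  ultimately show ?thesis
    by (metis compact_Int_closed compact_sphere)
qed

lemma normalize_mem_mean_zero_sphere:
  assumes "x \<noteq> 0" "x \<bullet> 1 = 0"
  shows "(1 / norm x) *\<^sub>R x \<in> mean_zero_sphere"
  using assms by (simp add: mean_zero_sphere_def)

lemma mean_zero_sphere_nonempty:
  assumes "CARD('n::finite) \<ge> 2"
  shows "(mean_zero_sphere :: (real^'n) set) \<noteq> {}"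
proof -
  obtain u v :: 'n where "u \<noteq> v"
    using assms card_2_iff' card_le_Suc0_iff_eq[of "UNIV :: 'n set"] by force
  let ?x = "axis u 1 - axis v 1 :: real^'n"
  have "?x \<bullet> 1 = 0"
    by (simp add: inner_diff_left inner_axis')
  moreover have "?x $ u \<noteq> 0"
    using \<open>u \<noteq> v\<close> by (simp add: axis_def)
  then have "?x \<noteq> 0" by force
  ultimately show ?thesis
    using normalize_mem_mean_zero_sphere by blast
qed

text \<open>Otherwise \<open>x\<close> would be constant, hence zero because its entries sum to
  zero, against \<open>norm x = 1\<close>.\<close>

lemma dirichlet_pos:
  assumes "\<forall>e\<in>E. 0 < h e" "connected_graph E" "x \<in> mean_zero_sphere"
  shows "0 < dirichlet E h x x"
proof (rule ccontr)
  assume "\<not> 0 < dirichlet E h x x"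
  with dirichlet_nonneg[OF assms(1), of x] have 0: "dirichlet E h x x = 0" by simp
  have "x $ v = 0" for v
  proof -
    have "0 = (\<Sum>u\<in>UNIV. x $ u)"
      using assms(3) by (simp add: mean_zero_sphere_def inner_one_vec)
    also have "\<dots> = (\<Sum>u\<in>(UNIV :: 'a set). x $ v)"
      by (intro sum.cong refl dirichlet_eq_0_imp_constant[OF assms(1,2) 0])
    finally show ?thesis by simp
  qed
  then have "x = 0" by (simp add: vec_eq_iff)
  then show False using assms(3) by (simp add: mean_zero_sphere_def)
qed

text \<open>Both sides are homogeneous of degree two, so the bound on unit vectors rescales.\<close>

lemma dirichlet_ge_on_mean_zero:
  assumes min: "\<And>y. y \<in> mean_zero_sphere \<Longrightarrow> m \<le> dirichlet E h y y" and "x \<bullet> 1 = 0"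
  shows "m * (x \<bullet> x) \<le> dirichlet E h x x"
proof (cases "x = 0")
  case True
  then show ?thesis by (simp add: dirichlet_def)
next
  case False
  have "m \<le> dirichlet E h ((1 / norm x) *\<^sub>R x) ((1 / norm x) *\<^sub>R x)"
    by (intro min normalize_mem_mean_zero_sphere False assms)
  also have "\<dots> = dirichlet E h x x / (x \<bullet> x)"
    by (simp add: dirichlet_scale_left dirichlet_scale_right power2_norm_eq_inner[symmetric]
        power2_eq_square)
  finally show ?thesis using False by (simp add: field_simps)
qed

lemma nonneg_quadratic_imp_linear_coeff_0:
  fixes b c :: real
  assumes "\<And>t. 0 \<le> 2 * t * b + t\<^sup>2 * c"
  shows "b = 0"
proof (rule ccontr)
  assume "b \<noteq> 0"
  \<comment> \<open>At \<open>t = - s * b\<close> the quadratic becomes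
    \<open>s * b\<^sup>2 * (s * c - 2)\<close>, so \<open>s\<close> only has to be positive with
    \<open>s * c < 2\<close>. The \<open>+ 1\<close> covers \<open>c = 0\<close>.\<close>
  define s where "s = 1 / (\<bar>c\<bar> + 1)"
  have s: "0 < s" "s * c < 2"
    unfolding s_def by (auto simp: field_simps)
  have "0 \<le> 2 * (- s * b) * b + (- s * b)\<^sup>2 * c" by (rule assms)
  also have "\<dots> = (s * b\<^sup>2) * (s * c - 2)"
    by (simp add: power2_eq_square algebra_simps)
  also have "\<dots> < 0"
    using s \<open>b \<noteq> 0\<close> by (intro mult_pos_neg) auto
  finally show False by simp
qed

text \<open>First variation: along mean-zero directions, the form minus \<open>m\<close> times the
  squared norm is nonnegative and vanishes at \<open>x\<close>, so its linear coefficient is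
  zero.\<close>

lemma minimizer_in_eigenspace:
  assumes min: "\<And>y. y \<in> mean_zero_sphere \<Longrightarrow> m \<le> dirichlet E h y y"
    and x: "x \<in> mean_zero_sphere" "dirichlet E h x x = m"
  shows "x \<in> eigenspace (laplacian E h) m"
proof -
  \<comment> \<open>The residual itself serves as the direction of variation, since the linear
    coefficient then equals \<open>z \<bullet> z\<close>.\<close>
  define z where "z = laplacian E h *v x - m *\<^sub>R x"
  have x0: "x \<bullet> 1 = 0" and xx: "x \<bullet> x = 1"
    using x(1) by (auto simp: mean_zero_sphere_def norm_eq_1)
  \<comment> \<open>By symmetry and \<open>laplacian_one\<close> the Laplacian has mean-zero values,
    so \<open>z\<close> is an admissible direction.\<close>
  have "(laplacian E h *v x) \<bullet> 1 = dirichlet E h 1 x"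
    using dirichlet_sym[of E h 1 x] by (simp add: dirichlet_def inner_commute)
  then have z0: "z \<bullet> 1 = 0"
    using x0 by (simp add: z_def dirichlet_def laplacian_one inner_diff_left)
  have "0 \<le> 2 * t * (dirichlet E h x z - m * (x \<bullet> z))
      + t\<^sup>2 * (dirichlet E h z z - m * (z \<bullet> z))" for t
  proof -
    have "(x + t *\<^sub>R z) \<bullet> 1 = 0"
      unfolding inner_add_left inner_scaleR_left z0 x0 by simp
    from dirichlet_ge_on_mean_zero[OF min this]
    have le: "m * ((x + t *\<^sub>R z) \<bullet> (x + t *\<^sub>R z)) \<le> dirichlet E h (x + t *\<^sub>R z) (x + t *\<^sub>R z)" .
    have D: "dirichlet E h (x + t *\<^sub>R z) (x + t *\<^sub>R z) =
        m + 2 * t * dirichlet E h x z + t\<^sup>2 * dirichlet E h z z"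
      unfolding dirichlet_add_left dirichlet_add_right dirichlet_scale_left dirichlet_scale_right
        dirichlet_sym[of E h z x] x(2)
      by (simp add: algebra_simps power2_eq_square)
    have N: "(x + t *\<^sub>R z) \<bullet> (x + t *\<^sub>R z) = 1 + 2 * t * (x \<bullet> z) + t\<^sup>2 * (z \<bullet> z)"
      unfolding inner_add_left inner_add_right inner_scaleR_left inner_scaleR_right
        inner_commute[of z x] xx
      by (simp add: algebra_simps power2_eq_square)
    show ?thesis
      using le unfolding D N by (simp add: algebra_simps)
  qed
  then have "dirichlet E h x z - m * (x \<bullet> z) = 0"
    by (rule nonneg_quadratic_imp_linear_coeff_0)
  moreover have "dirichlet E h x z - m * (x \<bullet> z) = z \<bullet> z"
    unfolding dirichlet_def z_def
    by (simp add: algebra_simps inner_diff_right inner_diff_left inner_commute)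
  ultimately have "z = 0" by simp
  then show ?thesis by (simp add: z_def eigenspace_def)
qed

text \<open>The form is symmetric and the constants have eigenvalue 0. Hence minimising over
  \<open>mean_zero_sphere\<close> overlooks no positive eigenvalue.\<close>

lemma eigenvector_orthogonal_one:
  assumes "x \<in> eigenspace (laplacian E h) l" "l \<noteq> 0"
  shows "x \<bullet> 1 = 0"
proof -
  have "l * (x \<bullet> 1) = dirichlet E h x 1"
    using assms(1) by (simp add: dirichlet_def eigenspace_def inner_commute)
  also have "\<dots> = 0"
    by (subst dirichlet_sym) (simp add: dirichlet_def laplacian_one)
  finally show ?thesis using assms(2) by simp
qed

text \<open>Compactness gives a minimizer, connectedness makes the minimum positive, and the first
  variation makes it an eigenvalue. Eigenvectors of other positive eigenvalues compete in the same
  minimum.\<close>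

lemma lambda1_rayleigh:
  assumes pos: "\<forall>e\<in>E. 0 < h e" and conn: "connected_graph E" and card: "CARD('n::finite) \<ge> 2"
  obtains x :: "real^'n" where "x \<in> mean_zero_sphere" "dirichlet E h x x = lambda1 E h"
    "0 < lambda1 E h" "\<And>y. y \<in> mean_zero_sphere \<Longrightarrow> lambda1 E h \<le> dirichlet E h y y"
proof -
  obtain x :: "real^'n" where x: "x \<in> mean_zero_sphere"
    and min: "\<And>y. y \<in> mean_zero_sphere \<Longrightarrow> dirichlet E h x x \<le> dirichlet E h y y"
    using continuous_attains_inf[OF compact_mean_zero_sphere mean_zero_sphere_nonempty[OF card]
        continuous_on_dirichlet] by blast
  let ?m = "dirichlet E h x x"
  have m: "0 < ?m" by (rule dirichlet_pos[OF pos conn x])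
  have "x \<noteq> 0" using x by (auto simp: mean_zero_sphere_def)
  \<comment> \<open>A set of reals may lack a least element, so \<open>LEAST\<close> is evaluated by
    exhibiting one.\<close>
  have "lambda1 E h = ?m"
    unfolding lambda1_def
  proof (rule Least_equality)
    show "0 < ?m \<and> is_eigenvalue (laplacian E h) ?m"
      using m minimizer_in_eigenspace[OF min x refl] \<open>x \<noteq> 0\<close> by (auto simp: is_eigenvalue_def)
  next
    fix l assume "0 < l \<and> is_eigenvalue (laplacian E h) l"
    then obtain y where y: "0 < l" "y \<in> eigenspace (laplacian E h) l" "y \<noteq> 0"
      by (auto simp: is_eigenvalue_def)
    have "y \<bullet> 1 = 0" using eigenvector_orthogonal_one[OF y(2)] y(1) by simp
    from dirichlet_ge_on_mean_zero[OF min this] have "?m * (y \<bullet> y) \<le> l * (y \<bullet> y)"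
      using y(2) by (simp add: dirichlet_def eigenspace_def)
    then show "?m \<le> l" using y(3) by simp
  qed
  with x m min show ?thesis by (intro that[of x]) auto
qed

text \<open>The sphere is split by the sign of the form of \<open>h\<close>. Where it is positive,
  moving along \<open>h\<close> helps at once; on the compact rest \<open>?V\<close> the form of
  \<open>f\<close> exceeds \<open>lambda1 E f\<close> by a uniform margin, which a small step cannot
  use up.\<close>

lemma lambda1_increases:
  fixes E :: "'n::finite set set"
  assumes pos: "\<forall>e\<in>E. 0 < f e" and conn: "connected_graph E" and card: "CARD('n) \<ge> 2"
    and up: "\<And>x. x \<in> eigenspace (laplacian E f) (lambda1 E f) \<Longrightarrow> norm x = 1 \<Longrightarrow>
      0 < dirichlet E h x x"
  shows "\<forall>\<^sub>F t in at_right 0. (\<forall>e\<in>E. 0 < f e + t * h e) \<longrightarrow>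
      lambda1 E f < lambda1 E (\<lambda>e. f e + t * h e)"
proof -
  let ?l = "lambda1 E f"
  let ?U = "mean_zero_sphere :: (real^'n) set"
  let ?V = "?U \<inter> {x. dirichlet E h x x \<le> 0}"
  obtain x0 where "x0 \<in> ?U" and min: "\<And>y. y \<in> ?U \<Longrightarrow> ?l \<le> dirichlet E f y y"
    using lambda1_rayleigh[OF pos conn card] by metis
  have "closed {x. dirichlet E h x x \<le> 0}"
    by (intro closed_Collect_le continuous_on_dirichlet continuous_intros)
  then have V: "compact ?V"
    by (rule compact_Int_closed[OF compact_mean_zero_sphere])
  \<comment> \<open>Equality would make \<open>x\<close> an eigenvector, where \<open>up\<close>
    contradicts membership in \<open>?V\<close>.\<close>
  have strict: "?l < dirichlet E f x x" if "x \<in> ?V" for x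
    using that min[of x] minimizer_in_eigenspace[OF min, of x] up[of x]
    by (cases "dirichlet E f x x = ?l") (auto simp: mean_zero_sphere_def)
  have "\<exists>\<epsilon>>0. \<forall>x\<in>?V. ?l + \<epsilon> \<le> dirichlet E f x x"
  proof (cases "?V = {}")
    case True
    then show ?thesis by (intro exI[of _ 1]) auto
  next
    case False
    from continuous_attains_inf[OF V this continuous_on_dirichlet, of E f]
    obtain z where "z \<in> ?V" "\<And>x. x \<in> ?V \<Longrightarrow> dirichlet E f z z \<le> dirichlet E f x x" by blast
    with strict[of z] show ?thesis
      by (intro exI[of _ "dirichlet E f z z - ?l"]) auto
  qed
  then obtain \<epsilon> where \<epsilon>: "0 < \<epsilon>" "\<And>x. x \<in> ?V \<Longrightarrow> ?l + \<epsilon> \<le> dirichlet E f x x" by blast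
  have "bounded ((\<lambda>x. dirichlet E h x x) ` ?U)"
    by (intro compact_imp_bounded compact_continuous_image continuous_on_dirichlet
        compact_mean_zero_sphere)
  then obtain M where M: "0 < M" "\<And>x. x \<in> ?U \<Longrightarrow> \<bar>dirichlet E h x x\<bar> \<le> M"
    by (auto simp: bounded_pos)
  \<comment> \<open>On the sphere the perturbation changes the form by at most \<open>t * M\<close>,
    which is below the margin for these \<open>t\<close>.\<close>
  have "\<forall>\<^sub>F t in at_right 0. t \<in> {0<..<\<epsilon> / M}"
    using \<epsilon>(1) M(1) by (intro eventually_at_right_real) auto
  then show ?thesis
  proof (rule eventually_mono, intro impI)
    fix t assume t: "t \<in> {0<..<\<epsilon> / M}" and pos': "\<forall>e\<in>E. 0 < f e + t * h e"
    \<comment> \<open>Since the new \<open>lambda1\<close> is attained at \<open>x\<close>, a strict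
      lower bound at this one vector suffices.\<close>
    obtain x :: "real^'n" where x: "x \<in> ?U"
      and eq: "dirichlet E (\<lambda>e. f e + t * h e) x x = lambda1 E (\<lambda>e. f e + t * h e)"
      using lambda1_rayleigh[OF pos' conn card] by metis
    have split: "dirichlet E (\<lambda>e. f e + t * h e) x x = dirichlet E f x x + t * dirichlet E h x x"
      by (simp add: dirichlet_weight_add dirichlet_weight_scale)
    have "?l < dirichlet E f x x + t * dirichlet E h x x"
    proof (cases "x \<in> ?V")
      case True
      have "t * (- dirichlet E h x x) \<le> t * M"
        using M(2)[OF x] t by (intro mult_left_mono) auto
      moreover have "t * M < \<epsilon>" using t M(1) by (simp add: field_simps)
      ultimately show ?thesis using \<epsilon>(2)[OF True] by simp
    next
      case False
      then have "0 < t * dirichlet E h x x" using x t by simp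
      with min[OF x] show ?thesis by linarith
    qed
    then show "?l < lambda1 E (\<lambda>e. f e + t * h e)" using eq split by simp
  qed
qed

section \<open>Rank-one matrices, the cone and the orthogonal complement\<close>

lemma outer_square_nth: "outer_square x $ i $ j = x $ i * x $ j"
  by (simp add: outer_square_def matrix_matrix_mult_def transpose_def columnvector_def)

lemma continuous_on_outer_square: "continuous_on (A :: (real^'n::finite) set) outer_square"
proof -
  have eq: "outer_square = (\<lambda>x::real^'n. \<chi> i j. x $ i * x $ j)"
    by (auto simp: fun_eq_iff vec_eq_iff outer_square_nth)
  show ?thesis unfolding eq by (intro continuous_intros)
qed

text \<open>This translates between matrices and forms: for \<open>A = laplacian E h\<close> the
  value is \<open>dirichlet E h x x\<close>.\<close>

lemma inner_outer_square: "outer_square x \<bullet> A = x \<bullet> (A *v x)"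
  by (simp add: inner_vec_def outer_square_nth matrix_vector_mult_def sum_distrib_left mult_ac)

lemma trace_mult_eq_inner: "trace ((A :: real^'n::finite^'n) ** B) = transpose A \<bullet> B"
  unfolding trace_def matrix_matrix_mult_def inner_vec_def transpose_def
  by simp (rule sum.swap)

text \<open>On symmetric matrices the trace pairing is the entrywise inner product, so Euclidean
  separation and orthogonality results apply.\<close>

lemma perp_iff: "A \<in> perp E H \<longleftrightarrow> transpose A = A \<and> (\<forall>h\<in>H. A \<bullet> laplacian E h = 0)"
  by (auto simp: perp_def trace_mult_eq_inner)

lemma transpose_sum_outer_squares:
  assumes "\<And>B. B \<in> F \<Longrightarrow> \<exists>x. B = outer_square x"
  shows "transpose (\<Sum>B\<in>F. c B *\<^sub>R B) = (\<Sum>B\<in>F. c B *\<^sub>R B)"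
proof -
  have "B $ i $ j = B $ j $ i" if "B \<in> F" for B i j
    using assms[OF that] by (auto simp: outer_square_nth)
  then show ?thesis
    by (simp add: vec_eq_iff transpose_def)
qed

text \<open>Coefficients of one strict sign that annihilate the pairings with \<open>f' - f\<close>
  force some pairing to be nonpositive. Its eigenvector is a test vector for the Rayleigh quotient
  of \<open>f'\<close>.\<close>

lemma lambda1_le_if_cone_meets_perp:
  fixes E :: "'n::finite set set"
  assumes pos: "\<forall>e\<in>E. 0 < f e" and pos': "\<forall>e\<in>E. 0 < f' e"
    and conn: "connected_graph E" and card: "CARD('n) \<ge> 2"
    and diff: "(\<lambda>e. f' e - f e) \<in> H"
    and meet: "perp E H \<inter> open_cone (eigen_squares E f) \<noteq> {}"
  shows "lambda1 E f' \<le> lambda1 E f"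
proof -
  let ?h = "\<lambda>e. f' e - f e"
  obtain F c where F: "finite F" "F \<noteq> {}" "F \<subseteq> eigen_squares E f"
    and sign: "(\<forall>B\<in>F. (0::real) < c B) \<or> (\<forall>B\<in>F. c B < 0)"
    and perp: "(\<Sum>B\<in>F. c B *\<^sub>R B) \<in> perp E H"
    using meet by (auto simp: open_cone_def)
  have zero: "(\<Sum>B\<in>F. c B * (B \<bullet> laplacian E ?h)) = 0"
    using perp diff by (auto simp: perp_iff inner_sum_left)
  have "\<exists>B\<in>F. B \<bullet> laplacian E ?h \<le> 0"
  proof (rule ccontr)
    assume "\<not> ?thesis"
    then have p: "\<And>B. B \<in> F \<Longrightarrow> 0 < B \<bullet> laplacian E ?h" by force
    from sign show False
    proof
      assume "\<forall>B\<in>F. 0 < c B"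
      then have "0 < (\<Sum>B\<in>F. c B * (B \<bullet> laplacian E ?h))"
        using F p by (intro sum_pos) auto
      with zero show False by simp
    next
      assume "\<forall>B\<in>F. c B < 0"
      then have "0 < (\<Sum>B\<in>F. - (c B * (B \<bullet> laplacian E ?h)))"
        using F p by (intro sum_pos) (auto intro: mult_neg_pos)
      with zero show False by (simp add: sum_negf)
    qed
  qed
  then obtain x where x: "x \<in> eigenspace (laplacian E f) (lambda1 E f)" "x \<noteq> 0"
    and le: "outer_square x \<bullet> laplacian E ?h \<le> 0"
    using F(3) by (auto simp: eigen_squares_def)
  have "0 < lambda1 E f" using lambda1_rayleigh[OF pos conn card] by metis
  then have x0: "x \<bullet> 1 = 0" using eigenvector_orthogonal_one[OF x(1)] by simp
  have "dirichlet E f' x x = dirichlet E (\<lambda>e. f e + ?h e) x x" by simp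
  also have "\<dots> = dirichlet E f x x + dirichlet E ?h x x" by (rule dirichlet_weight_add)
  also have "\<dots> \<le> dirichlet E f x x"
    using le by (simp add: inner_outer_square dirichlet_def)
  also have "\<dots> = lambda1 E f * (x \<bullet> x)"
    using x(1) by (simp add: dirichlet_def eigenspace_def)
  finally have "dirichlet E f' x x \<le> lambda1 E f * (x \<bullet> x)" .
  moreover have "lambda1 E f' * (x \<bullet> x) \<le> dirichlet E f' x x"
    using dirichlet_ge_on_mean_zero[OF _ x0] lambda1_rayleigh[OF pos' conn card] by metis
  ultimately have "lambda1 E f' * (x \<bullet> x) \<le> lambda1 E f * (x \<bullet> x)" by simp
  then show ?thesis using x(2) by simp
qed

text \<open>Separation of 0 from \<open>?C\<close>, the sum of the hull \<open>?K\<close> and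
  \<open>?W\<^sup>\<bottom>\<close>: a normal bounded below on a sum with a subspace must be
  orthogonal to that subspace, so it lies in \<open>?W\<close> and comes from some \<open>h\<close>
  in \<open>H\<close>.\<close>

lemma ascent_direction_if_cone_misses_perp:
  fixes E :: "'n::finite set set"
  assumes sub: "subspace (laplacian E ` H)"
    and miss: "perp E H \<inter> open_cone (eigen_squares E f) = {}"
  obtains h where "h \<in> H"
    "\<And>x. x \<in> eigenspace (laplacian E f) (lambda1 E f) \<Longrightarrow> norm x = 1 \<Longrightarrow> 0 < dirichlet E h x x"
proof -
  let ?W = "laplacian E ` H"
  let ?X = "eigenspace (laplacian E f) (lambda1 E f) \<inter> sphere 0 1"
  let ?K = "convex hull (outer_square ` ?X)"
  let ?C = "\<Union>A\<in>?K. \<Union>B\<in>?W\<^sup>\<bottom>. {A + B}"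
  have "closed (eigenspace (laplacian E f) (lambda1 E f))"
    unfolding eigenspace_def
    by (intro closed_Collect_eq continuous_intros linear_continuous_on
        matrix_vector_mul_bounded_linear)
  then have "compact ?X" by (simp add: closed_Int_compact)
  moreover have "continuous_on ?X outer_square"
    by (rule continuous_on_outer_square)
  ultimately have K: "compact ?K"
    by (intro compact_convex_hull compact_continuous_image)
  have "closed (?W\<^sup>\<bottom>)" by (intro closed_subspace subspace_orthogonal_comp)
  \<comment> \<open>Compactness of \<open>?K\<close> matters: a sum of two merely closed sets need
    not be closed.\<close>
  then have "closed ?C" by (rule compact_closed_sums[OF K])
  moreover have "convex ?C"
    by (intro convex_sums convex_convex_hull subspace_imp_convex subspace_orthogonal_comp)
  moreover have "0 \<notin> ?C"
  proof
    assume "0 \<in> ?C"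
    then obtain A B where A: "A \<in> ?K" and B: "B \<in> ?W\<^sup>\<bottom>" and "A + B = 0" by force
    then have AW: "A \<bullet> laplacian E h = 0" if "h \<in> H" for h
      using that by (auto simp: orthogonal_comp_def orthogonal_def eq_neg_iff_add_eq_0[symmetric]
          inner_commute)
    obtain F c where F: "finite F" "F \<subseteq> outer_square ` ?X" "\<And>B. B \<in> F \<Longrightarrow> 0 \<le> c B"
      "sum c F = 1" "A = (\<Sum>B\<in>F. c B *\<^sub>R B)"
      using A unfolding convex_hull_explicit by auto
    \<comment> \<open>Hull coefficients may vanish while the cone demands strict positivity; as they
      sum to 1, some survive.\<close>
    let ?G = "{B\<in>F. c B \<noteq> 0}"
    have "A = (\<Sum>B\<in>?G. c B *\<^sub>R B)"
      unfolding F(5) using F(1) by (intro sum.mono_neutral_right) auto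
    moreover have "?G \<noteq> {}"
    proof
      assume "?G = {}"
      then have "sum c F = 0" by (intro sum.neutral) auto
      with F(4) show False by simp
    qed
    moreover have "?G \<subseteq> eigen_squares E f"
      using F(2) by (force simp: eigen_squares_def)
    moreover have "\<forall>B\<in>?G. 0 < c B" using F(3) by force
    ultimately have "A \<in> open_cone (eigen_squares E f)"
      unfolding open_cone_def using F(1) by (intro CollectI exI[of _ ?G] exI[of _ c]) auto
    \<comment> \<open>\<open>?W\<^sup>\<bottom>\<close> also contains nonsymmetric matrices;
      \<open>A\<close> is symmetric as a combination of outer squares.\<close>
    moreover have "A \<in> perp E H"
      unfolding perp_iff F(5)
      using AW F(2,5) by (auto intro!: transpose_sum_outer_squares)
    ultimately show False using miss by blast
  qed
  ultimately obtain M b where b: "0 < b" and M: "\<And>A. A \<in> ?C \<Longrightarrow> b < M \<bullet> A"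
    using separating_hyperplane_closed_0[of ?C] by metis
  show ?thesis
  proof (cases "?X = {}")
    \<comment> \<open>Without unit eigenvectors the claim is vacuous, and any element of
      \<open>H\<close> serves.\<close>
    case True
    obtain h where "h \<in> H" using subspace_0[OF sub] by blast
    with True show ?thesis by (intro that[of h]) auto
  next
    case False
    then have "?K \<noteq> {}" by (simp only: convex_hull_eq_empty image_is_empty not_False_eq_True)
    then obtain A where A: "A \<in> ?K" by blast
    have "M \<bullet> B = 0" if B: "B \<in> ?W\<^sup>\<bottom>" for B
    proof (rule ccontr)
      assume nz: "M \<bullet> B \<noteq> 0"
      \<comment> \<open>This \<open>t\<close> is where the affine function
        \<open>M \<bullet> (A + t *\<^sub>R B)\<close> vanishes, although it must stay above
        \<open>b\<close>.\<close>
      define t where "t = - (M \<bullet> A) / (M \<bullet> B)"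
      have "t *\<^sub>R B \<in> ?W\<^sup>\<bottom>"
        by (intro subspace_scale subspace_orthogonal_comp B)
      with A have "A + t *\<^sub>R B \<in> ?C" by blast
      then have "b < M \<bullet> (A + t *\<^sub>R B)" by (rule M)
      also have "\<dots> = 0" using nz by (simp add: t_def inner_add_right inner_diff_right)
      finally show False using b by simp
    qed
    then have "M \<in> ?W\<^sup>\<bottom>\<^sup>\<bottom>"
      by (auto simp: orthogonal_comp_def[of "?W\<^sup>\<bottom>"] orthogonal_def inner_commute)
    then have "M \<in> ?W" by (simp add: orthogonal_comp_self[OF sub])
    then obtain h where h: "h \<in> H" "M = laplacian E h" by blast
    show ?thesis
    proof (rule that[OF h(1)])
      fix x assume "x \<in> eigenspace (laplacian E f) (lambda1 E f)" "norm x = 1"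
      then have "outer_square x \<in> ?K" by (intro hull_inc) auto
      moreover have "0 \<in> ?W\<^sup>\<bottom>" by (intro subspace_0 subspace_orthogonal_comp)
      ultimately have "outer_square x + 0 \<in> ?C" by blast
      from M[OF this] b show "0 < dirichlet E h x x"
        by (simp add: h(2) dirichlet_def inner_outer_square[symmetric] inner_commute)
    qed
  qed
qed

section \<open>Small perturbations and the criterion for abstract weight classes\<close>

lemma eventually_pos_perturbation:
  fixes f h :: "'a \<Rightarrow> real"
  assumes "finite A" "\<forall>a\<in>A. 0 < f a"
  shows "\<forall>\<^sub>F t in at_right 0. \<forall>a\<in>A. 0 < f a + t * h a"
proof (rule eventually_ball_finite[OF assms(1)], rule ballI)
  fix a assume "a \<in> A"
  have "((\<lambda>t. f a + t * h a) \<longlongrightarrow> f a + 0 * h a) (at_right 0)"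
    by (intro tendsto_intros)
  then show "\<forall>\<^sub>F t in at_right 0. 0 < f a + t * h a"
    using assms(2) \<open>a \<in> A\<close> by (intro order_tendstoD) auto
qed

text \<open>Collects what the three classes share: positive weights, differences that are tangent,
  short tangent moves that stay in \<open>S\<close>, and linearity of \<open>H\<close>.\<close>

lemma maximal_iff_cone_meets_perp:
  fixes E :: "'n::finite set set"
  assumes conn: "connected_graph E" and card: "CARD('n) \<ge> 2" and "f \<in> S"
    and pos: "\<And>f'. f' \<in> S \<Longrightarrow> \<forall>e\<in>E. 0 < f' e"
    and diff: "\<And>f'. f' \<in> S \<Longrightarrow> (\<lambda>e. f' e - f e) \<in> H"
    and move: "\<And>h. h \<in> H \<Longrightarrow> \<forall>\<^sub>F t in at_right 0. (\<lambda>e. f e + t * h e) \<in> S"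
    and zero: "(\<lambda>e. 0) \<in> H"
    and add: "\<And>h k. h \<in> H \<Longrightarrow> k \<in> H \<Longrightarrow> (\<lambda>e. h e + k e) \<in> H"
    and scale: "\<And>h c. h \<in> H \<Longrightarrow> (\<lambda>e. c * h e) \<in> H"
  shows "(\<forall>f'\<in>S. lambda1 E f' \<le> lambda1 E f) \<longleftrightarrow>
         perp E H \<inter> open_cone (eigen_squares E f) \<noteq> {}"
proof
  assume max: "\<forall>f'\<in>S. lambda1 E f' \<le> lambda1 E f"
  have "laplacian E (\<lambda>e. 0) = 0" using laplacian_scale[of E 0 "\<lambda>e. 0"] by simp
  then have sub: "subspace (laplacian E ` H)"
    using zero add scale
    by (auto simp: subspace_def laplacian_add[symmetric] laplacian_scale[symmetric] image_iff)
  show "perp E H \<inter> open_cone (eigen_squares E f) \<noteq> {}"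
  proof
    assume "perp E H \<inter> open_cone (eigen_squares E f) = {}"
    from ascent_direction_if_cone_misses_perp[OF sub this]
    obtain h where h: "h \<in> H" "\<And>x. x \<in> eigenspace (laplacian E f) (lambda1 E f) \<Longrightarrow>
      norm x = 1 \<Longrightarrow> 0 < dirichlet E h x x" by blast
    have "\<forall>\<^sub>F t in at_right 0. (\<forall>e\<in>E. 0 < f e + t * h e) \<longrightarrow>
        lambda1 E f < lambda1 E (\<lambda>e. f e + t * h e)"
      by (rule lambda1_increases[OF pos[OF \<open>f \<in> S\<close>] conn card]) (rule h(2))
    \<comment> \<open>The filter is nontrivial, so some \<open>t\<close> is both admissible and
      improving, against maximality.\<close>
    then have "\<forall>\<^sub>F t in at_right (0::real). False"
      using move[OF h(1)]
    proof eventually_elim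
      case (elim t)
      then have "lambda1 E f < lambda1 E (\<lambda>e. f e + t * h e)" using pos by blast
      with max elim(2) show False by force
    qed
    then show False by simp
  qed
next
  assume "perp E H \<inter> open_cone (eigen_squares E f) \<noteq> {}"
  then show "\<forall>f'\<in>S. lambda1 E f' \<le> lambda1 E f"
    using lambda1_le_if_cone_meets_perp pos diff conn card \<open>f \<in> S\<close> by blast
qed

section \<open>The weight classes P, T, C and their tangent spaces\<close>

lemma sum_incident:
  fixes h :: "'n::finite set \<Rightarrow> real"
  assumes "simple_graph E"
  shows "(\<Sum>v\<in>UNIV. \<Sum>e\<in>incident E v. h e) = 2 * (\<Sum>e\<in>E. h e)"
proof -
  have "(\<Sum>v\<in>UNIV. \<Sum>e\<in>incident E v. h e) = (\<Sum>e\<in>E. \<Sum>v | v \<in> UNIV \<and> v \<in> e. h e)"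
    unfolding incident_def by (rule sum.swap_restrict) auto
  also have "\<dots> = (\<Sum>e\<in>E. 2 * h e)"
    using assms by (intro sum.cong) (auto simp: simple_graph_def)
  finally show ?thesis by (simp add: sum_distrib_left)
qed

text \<open>Adding the vertex conditions counts each edge at both ends, so the total vanishes as
  well.\<close>

lemma tangent_T_subset_P:
  assumes "simple_graph E"
  shows "tangent_T E \<subseteq> tangent_P E"
proof
  fix h assume "h \<in> tangent_T E"
  then show "h \<in> tangent_P E"
    using sum_incident[OF assms, of h] by (simp add: tangent_T_def tangent_P_def)
qed

lemma weights_P_move:
  assumes "f \<in> weights_P E" "h \<in> tangent_P E"
  shows "\<forall>\<^sub>F t in at_right 0. (\<lambda>e. f e + t * h e) \<in> weights_P E"
proof -
  have "\<forall>\<^sub>F t in at_right 0. \<forall>e\<in>E. 0 < f e + t * h e"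
    using assms(1) by (intro eventually_pos_perturbation) (auto simp: weights_P_def)
  then show ?thesis
    by (rule eventually_mono)
      (use assms in \<open>auto simp: weights_P_def tangent_P_def sum.distrib sum_distrib_left[symmetric]\<close>)
qed

lemma weights_T_move:
  assumes "simple_graph E" "f \<in> weights_T E" "h \<in> tangent_T E"
  shows "\<forall>\<^sub>F t in at_right 0. (\<lambda>e. f e + t * h e) \<in> weights_T E"
proof -
  have "\<forall>\<^sub>F t in at_right 0. (\<lambda>e. f e + t * h e) \<in> weights_P E"
    using assms tangent_T_subset_P by (intro weights_P_move) (auto simp: weights_T_def)
  then show ?thesis
    by (rule eventually_mono)
      (use assms in \<open>auto simp: weights_T_def tangent_T_def sum.distrib sum_distrib_left[symmetric]\<close>)
qed

lemma weights_C_move: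
  assumes "f \<in> weights_C E" "h \<in> tangent_C E"
  shows "\<forall>\<^sub>F t in at_right 0. (\<lambda>e. f e + t * h e) \<in> weights_C E"
proof -
  obtain g where g: "\<forall>v. 0 < g v" "\<forall>v w. {v, w} \<in> E \<longrightarrow> f {v, w} = g v + g w"
    using assms(1) by (auto simp: weights_C_def)
  obtain a where a: "\<forall>v w. {v, w} \<in> E \<longrightarrow> h {v, w} = a v + a w"
    using assms(2) by (auto simp: tangent_C_def)
  \<comment> \<open>\<open>weights_C\<close> requires a positive vertex function, which positive
    edge weights do not guarantee, so \<open>g\<close> itself is perturbed.\<close>
  have "\<forall>\<^sub>F t in at_right 0. \<forall>v\<in>UNIV. 0 < g v + t * a v"
    using g by (intro eventually_pos_perturbation) auto
  moreover have "\<forall>\<^sub>F t in at_right 0. (\<lambda>e. f e + t * h e) \<in> weights_P E"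
    using assms by (intro weights_P_move) (auto simp: weights_C_def tangent_C_def tangent_P_def)
  ultimately show ?thesis
  proof eventually_elim
    case (elim t)
    have "\<forall>v w. {v, w} \<in> E \<longrightarrow>
        f {v, w} + t * h {v, w} = (g v + t * a v) + (g w + t * a w)"
      using g(2) a by (simp add: algebra_simps)
    with elim show ?case
      unfolding weights_C_def by (intro CollectI conjI exI[of _ "\<lambda>v. g v + t * a v"]) auto
  qed
qed

lemma weights_C_diff:
  assumes "f \<in> weights_C E" "f' \<in> weights_C E"
  shows "(\<lambda>e. f' e - f e) \<in> tangent_C E"
proof -
  obtain g where "\<forall>v w. {v, w} \<in> E \<longrightarrow> f {v, w} = g v + g w"
    using assms(1) by (auto simp: weights_C_def)
  moreover obtain g' where "\<forall>v w. {v, w} \<in> E \<longrightarrow> f' {v, w} = g' v + g' w"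
    using assms(2) by (auto simp: weights_C_def)
  ultimately have "\<forall>v w. {v, w} \<in> E \<longrightarrow> f' {v, w} - f {v, w} = (g' v - g v) + (g' w - g w)"
    by simp
  moreover have "(\<Sum>e\<in>E. f' e - f e) = 0"
    using assms by (simp add: weights_C_def weights_P_def sum_subtractf)
  ultimately show ?thesis
    unfolding tangent_C_def by (intro CollectI conjI exI[of _ "\<lambda>v. g' v - g v"]) auto
qed

lemma tangent_C_add:
  assumes "h \<in> tangent_C E" "k \<in> tangent_C E"
  shows "(\<lambda>e. h e + k e) \<in> tangent_C E"
proof -
  obtain a where "\<forall>v w. {v, w} \<in> E \<longrightarrow> h {v, w} = a v + a w"
    using assms(1) by (auto simp: tangent_C_def)
  moreover obtain b where "\<forall>v w. {v, w} \<in> E \<longrightarrow> k {v, w} = b v + b w"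
    using assms(2) by (auto simp: tangent_C_def)
  ultimately have "\<forall>v w. {v, w} \<in> E \<longrightarrow> h {v, w} + k {v, w} = (a v + b v) + (a w + b w)"
    by simp
  moreover have "(\<Sum>e\<in>E. h e + k e) = 0"
    using assms by (simp add: tangent_C_def sum.distrib)
  ultimately show ?thesis
    unfolding tangent_C_def by (intro CollectI conjI exI[of _ "\<lambda>v. a v + b v"]) auto
qed

lemma tangent_C_scale:
  assumes "h \<in> tangent_C E"
  shows "(\<lambda>e. c * h e) \<in> tangent_C E"
proof -
  obtain a where "\<forall>v w. {v, w} \<in> E \<longrightarrow> h {v, w} = a v + a w"
    using assms by (auto simp: tangent_C_def)
  then have "\<forall>v w. {v, w} \<in> E \<longrightarrow> c * h {v, w} = c * a v + c * a w"
    by (simp add: algebra_simps)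
  moreover have "(\<Sum>e\<in>E. c * h e) = 0"
    using assms by (simp add: tangent_C_def sum_distrib_left[symmetric])
  ultimately show ?thesis
    unfolding tangent_C_def by (intro CollectI conjI exI[of _ "\<lambda>v. c * a v"]) auto
qed

theorem theorem10:
  fixes E :: "'n::finite set set"
    and S H :: "('n set \<Rightarrow> real) set"
    and f :: "'n set \<Rightarrow> real"
  assumes "simple_graph E"
    and "connected_graph E"
    and "CARD('n) \<ge> 2"
    and "(S, H) \<in> {(weights_P E, tangent_P E), (weights_T E, tangent_T E), (weights_C E, tangent_C E)}"
    and "f \<in> S"
  shows "(\<forall>f'\<in>S. lambda1 E f' \<le> lambda1 E f) \<longleftrightarrow>
         perp E H \<inter> open_cone (eigen_squares E f) \<noteq> {}"
proof -
  consider (P) "S = weights_P E" "H = tangent_P E" | (T) "S = weights_T E" "H = tangent_T E"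
    | (C) "S = weights_C E" "H = tangent_C E"
    using assms(4) by blast
  then show ?thesis
  proof cases
    case P
    show ?thesis
      using assms(5) unfolding P
      by (intro maximal_iff_cone_meets_perp assms(2,3) weights_P_move)
        (auto simp: weights_P_def tangent_P_def sum_subtractf sum.distrib sum_distrib_left[symmetric])
  next
    case T
    show ?thesis
      using assms(5) unfolding T
      by (intro maximal_iff_cone_meets_perp assms(2,3) weights_T_move[OF assms(1)])
        (auto simp: weights_P_def weights_T_def tangent_T_def sum_subtractf sum.distrib
          sum_distrib_left[symmetric])
  next
    case C
    have "(\<lambda>e. 0) \<in> tangent_C E"
      by (auto simp: tangent_C_def intro!: exI[of _ "\<lambda>v. 0"])
    moreover have "\<forall>e\<in>E. 0 < f' e" if "f' \<in> weights_C E" for f'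
      using that by (simp add: weights_C_def weights_P_def)
    ultimately show ?thesis
      using assms(5) unfolding C
      by (intro maximal_iff_cone_meets_perp assms(2,3) weights_C_move weights_C_diff
          tangent_C_add tangent_C_scale)
  qed
qed

end
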